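(* Let $h$ and $\hbar$ be valid Control Barrier Functions (CBFs) for the system $\dot x=f(x)+g(x)u$ and let them be parallel, i.e. $h(x)+\hbar(x)=b$ for a constant $b>0$. With $$\underline{\eta}(x):=-L_fh(x)-\alpha(h(x)),\qquad \overline{\eta}(x):=-L_fh(x)+\overline{\alpha}(b-h(x)),$$ where $\alpha,\overline{\alpha}$ are the extended class $\mathcal{K}_\infty$ functions appearing in the CBF conditions of $h$ and $\hbar$, one has $$L_gh(x)=0\implies \underline{\eta}(x)\le 0\le\overline{\eta}(x).$$ Moreover, there exist extended class $\mathcal{K}_\infty$ functions $\alpha$ and $\overline{\alpha}$ such that $\underline{\eta}(x)\le\overline{\eta}(x)$ for all $x\in D$. Thus, $h$ and $\hbar$ have the control-sharing property, and the quadratic program $$\min_{u}\ \tfrac12\|u-u_0\|^2\quad\text{subject to}\quad \underline{\eta}(x)\le L_gh(x)u\le\overline{\eta}(x)$$ is always feasible.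
   Context: System: $\dot x=f(x)+g(x)u$ with $x\in D\subseteq\mathbb{R}^n$ and unbounded input $u\in\mathbb{R}^m$; $u_0\in\mathbb{R}^m$ denotes a nominal control. For continuously differentiable $h:D\to\mathbb{R}$, $L_fh(x)=\nabla h(x)^\top f(x)$ and $L_gh(x)=\nabla h(x)^\top g(x)$ (a $1\times m$ row vector). The setting is that $h$ and $\hbar$ both have relative degree one (the input appears in the first time derivative), but $L_gh$ is allowed to vanish at some points of $D$. Extended class $\mathcal{K}_\infty$ function: a continuous strictly increasing $\alpha:\mathbb{R}\to\mathbb{R}$ with $\alpha(0)=0$ and $\alpha(s)\to\pm\infty$ as $s\to\pm\infty$. Barrier function candidate: a continuously differentiable $h:D\to\mathbb{R}$ with $\inf_{x\in D}h(x)<0$ and $\sup_{x\in D}h(x)>0$. Control Barrier Function (CBF): a continuously differentiable $h:D\to\mathbb{R}$ for which there exists an extended class $\mathcal{K}_\infty$ function $\alpha$ such that $\sup_{u}[L_fh(x)+L_gh(x)u]\ge-\alpha(h(x))$. Since $u$ is unbounded, this is equivalent to: $L_gh(x)=0\implies L_fh(x)\ge-\alpha(h(x))$. Parallel: a pair of candidate CBFs $h,\hbar$ is parallel if there is a constant $b>0$ such that $h(x)+\hbar(x)=b$; in particular $\nabla h=-\nabla\hbar$, so $L_f\hbar=-L_fh$ and $L_g\hbar=-L_gh$. The CBF conditions imposed on the input are $L_fh(x)+L_gh(x)u\ge-\alpha(h(x))$ and $L_f\hbar(x)+L_g\hbar(x)u\ge-\overline{\alpha}(\hbar(x))$, with $\alpha,\overline{\alpha}$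 extended class $\mathcal{K}_\infty$ functions; for a parallel pair they are jointly equivalent to $\underline{\eta}(x)\le L_gh(x)u\le\overline{\eta}(x)$. Control-sharing property: for every $x\in D$ there is a single $u\in\mathbb{R}^m$ satisfying both of these CBF conditions. *)

theory Defs
  imports "HOL-Analysis.Analysis"
begin

text \<open>
  The system is \<open>x' = f x + g x u\<close> with state in \<open>real ^ 'n\<close> and unbounded input in \<open>real ^ 'm\<close>;
  \<open>g x\<close> is an \<open>n \<times> m\<close> matrix. All functions are total, only their values on \<open>D\<close> matter.
\<close>

definition gradient :: "(real ^ 'n \<Rightarrow> real) \<Rightarrow> real ^ 'n \<Rightarrow> real ^ 'n" where
  "gradient h x = (THE d. GDERIV h x :> d)"

lemma gradient_eqI:
  assumes "GDERIV h x :> d"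
  shows "gradient h x = d"
  unfolding gradient_def
proof (rule the_equality)
  fix e assume "GDERIV h x :> e"
  with assms have "(\<lambda>v. v \<bullet> e) = (\<lambda>v. v \<bullet> d)"
    unfolding gderiv_def by (blast intro: has_derivative_unique)
  then show "e = d"
    by (metis vector_eq_ldot)
qed (fact assms)

text \<open>To be used for open \<open>D\<close>, since the derivative is the two-sided one at every point of \<open>D\<close>.\<close>

definition continuously_differentiable_on :: "(real ^ 'n \<Rightarrow> real) \<Rightarrow> (real ^ 'n) set \<Rightarrow> bool" where
  "continuously_differentiable_on h D \<longleftrightarrow>
     (\<forall>x\<in>D. h differentiable (at x)) \<and> continuous_on D (gradient h)"

definition Lie_f :: "(real ^ 'n \<Rightarrow> real ^ 'n) \<Rightarrow> (real ^ 'n \<Rightarrow> real) \<Rightarrow> real ^ 'n \<Rightarrow> real" where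
  "Lie_f f h x = gradient h x \<bullet> f x"

text \<open>The row vector \<open>\<nabla>h(x)\<^sup>T g(x)\<close>; its product with an input \<open>u\<close> is \<open>Lie_g g h x \<bullet> u\<close>.\<close>

definition Lie_g :: "(real ^ 'n \<Rightarrow> real ^ 'm ^ 'n) \<Rightarrow> (real ^ 'n \<Rightarrow> real) \<Rightarrow> real ^ 'n \<Rightarrow> real ^ 'm" where
  "Lie_g g h x = gradient h x v* g x"

definition ext_class_K_inf :: "(real \<Rightarrow> real) \<Rightarrow> bool" where
  "ext_class_K_inf \<alpha> \<longleftrightarrow>
     continuous_on UNIV \<alpha> \<and> strict_mono \<alpha> \<and> \<alpha> 0 = 0 \<and>
     filterlim \<alpha> at_top at_top \<and> filterlim \<alpha> at_bot at_bot"

text \<open>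
  The supremum over the unbounded input is taken in the extended reals, because it is infinite
  whenever \<open>Lie_g g h x \<noteq> 0\<close>.
\<close>

definition CBF_with ::
  "(real ^ 'n \<Rightarrow> real ^ 'n) \<Rightarrow> (real ^ 'n \<Rightarrow> real ^ 'm ^ 'n) \<Rightarrow> (real ^ 'n) set \<Rightarrow>
   (real ^ 'n \<Rightarrow> real) \<Rightarrow> (real \<Rightarrow> real) \<Rightarrow> bool" where
  "CBF_with f g D h \<alpha> \<longleftrightarrow>
     continuously_differentiable_on h D \<and> ext_class_K_inf \<alpha> \<and>
     (\<forall>x\<in>D. (SUP u. ereal (Lie_f f h x + Lie_g g h x \<bullet> u)) \<ge> ereal (- \<alpha> (h x)))"

definition CBF ::
  "(real ^ 'n \<Rightarrow> real ^ 'n) \<Rightarrow> (real ^ 'n \<Rightarrow> real ^ 'm ^ 'n) \<Rightarrow> (real ^ 'n) set \<Rightarrow>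
   (real ^ 'n \<Rightarrow> real) \<Rightarrow> bool" where
  "CBF f g D h \<longleftrightarrow> (\<exists>\<alpha>. CBF_with f g D h \<alpha>)"

definition parallel ::
  "(real ^ 'n) set \<Rightarrow> real \<Rightarrow> (real ^ 'n \<Rightarrow> real) \<Rightarrow> (real ^ 'n \<Rightarrow> real) \<Rightarrow> bool" where
  "parallel D b h hbar \<longleftrightarrow> b > 0 \<and> (\<forall>x\<in>D. h x + hbar x = b)"

definition CBF_condition ::
  "(real ^ 'n \<Rightarrow> real ^ 'n) \<Rightarrow> (real ^ 'n \<Rightarrow> real ^ 'm ^ 'n) \<Rightarrow>
   (real ^ 'n \<Rightarrow> real) \<Rightarrow> (real \<Rightarrow> real) \<Rightarrow> real ^ 'n \<Rightarrow> real ^ 'm \<Rightarrow> bool" where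
  "CBF_condition f g h \<alpha> x u \<longleftrightarrow> Lie_f f h x + Lie_g g h x \<bullet> u \<ge> - \<alpha> (h x)"

definition control_sharing ::
  "(real ^ 'n \<Rightarrow> real ^ 'n) \<Rightarrow> (real ^ 'n \<Rightarrow> real ^ 'm ^ 'n) \<Rightarrow> (real ^ 'n) set \<Rightarrow>
   (real ^ 'n \<Rightarrow> real) \<Rightarrow> (real \<Rightarrow> real) \<Rightarrow> (real ^ 'n \<Rightarrow> real) \<Rightarrow> (real \<Rightarrow> real) \<Rightarrow> bool" where
  "control_sharing f g D h \<alpha> hbar \<alpha>bar \<longleftrightarrow>
     (\<forall>x\<in>D. \<exists>u. CBF_condition f g h \<alpha> x u \<and> CBF_condition f g hbar \<alpha>bar x u)"

definition eta_lower ::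
  "(real ^ 'n \<Rightarrow> real ^ 'n) \<Rightarrow> (real ^ 'n \<Rightarrow> real) \<Rightarrow> (real \<Rightarrow> real) \<Rightarrow> real ^ 'n \<Rightarrow> real" where
  "eta_lower f h \<alpha> x = - Lie_f f h x - \<alpha> (h x)"

definition eta_upper ::
  "(real ^ 'n \<Rightarrow> real ^ 'n) \<Rightarrow> (real ^ 'n \<Rightarrow> real) \<Rightarrow> real \<Rightarrow> (real \<Rightarrow> real) \<Rightarrow> real ^ 'n \<Rightarrow> real" where
  "eta_upper f h b \<alpha>bar x = - Lie_f f h x + \<alpha>bar (b - h x)"

text \<open>A minimisation problem is a pair of an objective and a constraint set.\<close>

type_synonym 'u program = "('u \<Rightarrow> real) \<times> 'u set"

definition feasible :: "'u program \<Rightarrow> bool" where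
  "feasible P \<longleftrightarrow> snd P \<noteq> {}"

definition safety_QP ::
  "(real ^ 'n \<Rightarrow> real ^ 'n) \<Rightarrow> (real ^ 'n \<Rightarrow> real ^ 'm ^ 'n) \<Rightarrow> (real ^ 'n \<Rightarrow> real) \<Rightarrow> real \<Rightarrow>
   (real \<Rightarrow> real) \<Rightarrow> (real \<Rightarrow> real) \<Rightarrow> real ^ 'm \<Rightarrow> real ^ 'n \<Rightarrow> (real ^ 'm) program" where
  "safety_QP f g h b \<alpha> \<alpha>bar u0 x =
     (\<lambda>u. 1 / 2 * (norm (u - u0))\<^sup>2,
      {u. eta_lower f h \<alpha> x \<le> Lie_g g h x \<bullet> u \<and> Lie_g g h x \<bullet> u \<le> eta_upper f h b \<alpha>bar x})"

end

theory Submission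
  imports Defs
begin

text \<open>
  Along a parallel pair the gradients are opposite, so the two constraints on the input say that
  the single number \<open>Lie_g g h x \<bullet> u\<close> lies in the interval from \<open>eta_lower\<close> to \<open>eta_upper\<close>. Where
  \<open>Lie_g g h x\<close> vanishes this number is \<open>0\<close>, and the CBF property of \<open>h\<close> and of \<open>hbar\<close> says precisely
  that \<open>0\<close> lies in the interval. Everywhere else \<open>u\<close> can be chosen to give the number any value.
  Hence the program is feasible exactly if the interval is nonempty, and \<open>Lie_f f h x\<close>
  cancels from that requirement: it reads \<open>\<alpha> s + \<alpha>bar (b - s) \<ge> 0\<close> at \<open>s = h x\<close>.

  To satisfy it, keep the function \<open>\<alpha>bar\<close> that comes with \<open>hbar\<close> and raise the \<open>\<alpha>\<close> that comes with \<open>h\<close>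
  to \<open>s \<mapsto> max (\<alpha> s) (- \<alpha>bar (b - s))\<close>. Raising \<open>\<alpha>\<close> only weakens the CBF condition of \<open>h\<close>. The
  function \<open>s \<mapsto> - \<alpha>bar (b - s)\<close> is \<open>\<alpha>bar\<close> reflected in the point \<open>(b/2, 0)\<close>: it is
  increasing and unbounded in both directions, and its zero is at \<open>b > 0\<close>, so it is negative at the
  origin and the maximum still vanishes there.
\<close>

section \<open>Gradients of a parallel pair\<close>

text \<open>
  The derivative is a linear functional, and its adjoint applied to \<open>1\<close> is the vector that
  represents it.
\<close>

lemma GDERIV_gradient:
  fixes h :: "real ^ 'n \<Rightarrow> real"
  assumes "h differentiable (at x)"
  shows "GDERIV h x :> gradient h x"
proof -
  obtain h' where h': "(h has_derivative h') (at x)"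
    using assms unfolding differentiable_def by blast
  then have "linear h'"
    by (rule has_derivative_linear)
  then have "h' = (\<lambda>v. v \<bullet> adjoint h' 1)"
    by (simp add: fun_eq_iff adjoint_works)
  with h' have "GDERIV h x :> adjoint h' 1"
    unfolding gderiv_def by metis
  then show ?thesis
    using gradient_eqI by metis
qed

text \<open>
  The pair sums to \<open>b\<close> only on \<open>D\<close>; the two-sided derivative sees this because \<open>D\<close> is a
  neighbourhood of each of its points.
\<close>

lemma gradient_parallel:
  assumes "open D" and "parallel D b h hbar" and "x \<in> D" and "h differentiable (at x)"
  shows "gradient hbar x = - gradient h x"
proof (rule gradient_eqI)
  have "GDERIV (\<lambda>y. b - h y) x :> - gradient h x"
    using GDERIV_diff[OF GDERIV_const GDERIV_gradient[OF assms(4)], of b] by simp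
  then show "GDERIV hbar x :> - gradient h x"
    unfolding gderiv_def
    by (rule has_derivative_transform_within_open[OF _ assms(1,3)])
       (use assms(2) in \<open>auto simp: parallel_def algebra_simps\<close>)
qed

lemma Lie_parallel:
  assumes "open D" and "parallel D b h hbar" and "x \<in> D" and "h differentiable (at x)"
  shows "Lie_f f hbar x = - Lie_f f h x" and "Lie_g g hbar x = - Lie_g g h x"
proof -
  note grad = gradient_parallel[OF assms]
  show "Lie_f f hbar x = - Lie_f f h x"
    by (simp add: Lie_f_def grad)
  show "Lie_g g hbar x = - Lie_g g h x"
    by (simp add: Lie_g_def grad vec_eq_iff vector_matrix_mult_def sum_negf)
qed

lemma CBF_with_differentiable:
  "CBF_with f g D h \<alpha> \<Longrightarrow> x \<in> D \<Longrightarrow> h differentiable (at x)"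
  by (simp add: CBF_with_def continuously_differentiable_on_def)

section \<open>The constraint interval\<close>

lemma CBF_with_Lie_g_zero:
  assumes "CBF_with f g D h \<alpha>" and "x \<in> D" and "Lie_g g h x = 0"
  shows "- \<alpha> (h x) \<le> Lie_f f h x"
proof -
  have "ereal (- \<alpha> (h x)) \<le> (SUP u. ereal (Lie_f f h x + Lie_g g h x \<bullet> u))"
    using assms(1,2) by (simp add: CBF_with_def)
  also have "\<dots> = ereal (Lie_f f h x)"
    by (simp add: assms(3))
  finally show ?thesis by simp
qed

lemma eta_sign_where_Lie_g_zero:
  assumes "open D" and "parallel D b h hbar"
    and "CBF_with f g D h \<alpha>" and "CBF_with f g D hbar \<alpha>bar"
    and "x \<in> D" and "Lie_g g h x = 0"
  shows "eta_lower f h \<alpha> x \<le> 0" and "0 \<le> eta_upper f h b \<alpha>bar x"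
proof -
  note Lie = Lie_parallel[OF assms(1,2,5) CBF_with_differentiable[OF assms(3,5)]]
  have hbar: "hbar x = b - h x"
    using assms(2,5) by (auto simp: parallel_def algebra_simps)
  show "eta_lower f h \<alpha> x \<le> 0"
    using CBF_with_Lie_g_zero[OF assms(3,5,6)] by (simp add: eta_lower_def)
  have "Lie_g g hbar x = 0"
    by (simp add: Lie(2) assms(6))
  then have "- \<alpha>bar (hbar x) \<le> Lie_f f hbar x"
    by (rule CBF_with_Lie_g_zero[OF assms(4,5)])
  then show "0 \<le> eta_upper f h b \<alpha>bar x"
    by (simp add: eta_upper_def Lie(1) hbar)
qed

lemma CBF_conditions_iff_interval:
  assumes "open D" and "parallel D b h hbar" and "x \<in> D" and "h differentiable (at x)"
  shows "CBF_condition f g h \<alpha> x u \<and> CBF_condition f g hbar \<alpha>bar x u \<longleftrightarrow>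
     eta_lower f h \<alpha> x \<le> Lie_g g h x \<bullet> u \<and> Lie_g g h x \<bullet> u \<le> eta_upper f h b \<alpha>bar x"
proof -
  have "hbar x = b - h x"
    using assms(2,3) by (auto simp: parallel_def algebra_simps)
  then show ?thesis
    by (auto simp: CBF_condition_def eta_lower_def eta_upper_def Lie_parallel[OF assms])
qed

text \<open>
  A nonzero linear functional is onto the reals, while the zero functional attains
  only \<open>0\<close>; this is why the sign condition is wanted exactly where the functional vanishes.
\<close>

lemma ex_inner_between:
  fixes v :: "'a::real_inner"
  assumes "l \<le> r" and "v = 0 \<Longrightarrow> l \<le> 0 \<and> 0 \<le> r"
  shows "\<exists>u. l \<le> v \<bullet> u \<and> v \<bullet> u \<le> r"
proof (cases "v = 0")
  case True
  with assms(2) show ?thesis by simp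
next
  case False
  then have "v \<bullet> ((l / (v \<bullet> v)) *\<^sub>R v) = l"
    by simp
  with assms(1) show ?thesis
    by (metis order_refl)
qed

lemma control_sharing_and_feasible:
  assumes "open D" and "parallel D b h hbar"
    and "CBF_with f g D h \<alpha>" and "CBF_with f g D hbar \<alpha>bar"
    and "\<forall>x\<in>D. eta_lower f h \<alpha> x \<le> eta_upper f h b \<alpha>bar x"
  shows "control_sharing f g D h \<alpha> hbar \<alpha>bar"
    and "\<forall>u0. \<forall>x\<in>D. feasible (safety_QP f g h b \<alpha> \<alpha>bar u0 x)"
proof -
  have ex: "\<exists>u. eta_lower f h \<alpha> x \<le> Lie_g g h x \<bullet> u \<and> Lie_g g h x \<bullet> u \<le> eta_upper f h b \<alpha>bar x"
    if "x \<in> D" for x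
    using that assms(5) eta_sign_where_Lie_g_zero[OF assms(1-4) that]
    by (intro ex_inner_between) auto
  then show "control_sharing f g D h \<alpha> hbar \<alpha>bar"
    unfolding control_sharing_def
    using CBF_conditions_iff_interval[OF assms(1,2)] CBF_with_differentiable[OF assms(3)]
    by metis
  show "\<forall>u0. \<forall>x\<in>D. feasible (safety_QP f g h b \<alpha> \<alpha>bar u0 x)"
    using ex by (simp add: feasible_def safety_QP_def)
qed

section \<open>Raising the class K function\<close>

text \<open>
  Towards \<open>\<infinity>\<close> it is enough that one branch diverges, towards \<open>-\<infinity>\<close> both have to. At \<open>0\<close> the
  second branch is \<open>- \<beta> b\<close>; the assumption \<open>b > 0\<close> makes it negative, so that \<open>\<alpha> 0 = 0\<close> wins.
\<close>

lemma ext_class_K_inf_max_reflect: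
  assumes "ext_class_K_inf \<alpha>" and "ext_class_K_inf \<beta>" and "b > 0"
  shows "ext_class_K_inf (\<lambda>s. max (\<alpha> s) (- \<beta> (b - s)))" (is "ext_class_K_inf ?m")
proof -
  have \<alpha>: "continuous_on UNIV \<alpha>" "strict_mono \<alpha>" "\<alpha> 0 = 0"
      "filterlim \<alpha> at_top at_top" "filterlim \<alpha> at_bot at_bot"
    and \<beta>: "continuous_on UNIV \<beta>" "strict_mono \<beta>" "\<beta> 0 = 0" "filterlim \<beta> at_top at_top"
    using assms(1,2) by (auto simp: ext_class_K_inf_def)
  have "continuous_on UNIV ?m"
    by (intro continuous_intros \<alpha>(1) continuous_on_compose2[OF \<beta>(1)]) auto
  moreover have "strict_mono ?m"
  proof (rule strict_monoI)
    fix s t :: real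
    assume "s < t"
    then have "\<alpha> s < \<alpha> t" and "\<beta> (b - t) < \<beta> (b - s)"
      using \<alpha>(2) \<beta>(2) by (auto simp: strict_mono_def)
    then show "?m s < ?m t"
      by linarith
  qed
  moreover have "?m 0 = 0"
    using \<alpha>(3) \<beta>(3) strict_monoD[OF \<beta>(2) assms(3)] by simp
  moreover have "filterlim ?m at_top at_top"
    by (rule filterlim_at_top_mono[OF \<alpha>(4)]) simp
  moreover have "filterlim ?m at_bot at_bot"
  proof -
    have "filterlim (\<lambda>s::real. b - s) at_top at_bot"
      using filterlim_tendsto_add_at_top[OF tendsto_const filterlim_uminus_at_top_at_bot, of b]
      by simp
    then have "filterlim (\<lambda>s. \<beta> (b - s)) at_top at_bot"
      by (rule filterlim_compose[OF \<beta>(4)])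
    then have "filterlim (\<lambda>s. - \<beta> (b - s)) at_bot at_bot"
      by (simp add: filterlim_uminus_at_top)
    with \<alpha>(5) show ?thesis
      unfolding filterlim_at_bot by (simp add: eventually_conj_iff)
  qed
  ultimately show ?thesis
    by (simp add: ext_class_K_inf_def)
qed

text \<open>A larger \<open>\<beta>\<close> lowers the bound that the supremum over the input has to reach.\<close>

lemma CBF_with_mono:
  assumes "CBF_with f g D h \<alpha>" and "ext_class_K_inf \<beta>" and "\<And>s. \<alpha> s \<le> \<beta> s"
  shows "CBF_with f g D h \<beta>"
proof -
  have "ereal (- \<beta> (h x)) \<le> (SUP u. ereal (Lie_f f h x + Lie_g g h x \<bullet> u))" if "x \<in> D" for x
  proof -
    have "ereal (- \<beta> (h x)) \<le> ereal (- \<alpha> (h x))"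
      by (simp add: assms(3))
    also have "\<dots> \<le> (SUP u. ereal (Lie_f f h x + Lie_g g h x \<bullet> u))"
      using assms(1) that by (simp add: CBF_with_def)
    finally show ?thesis .
  qed
  with assms(1,2) show ?thesis
    by (simp add: CBF_with_def)
qed

text \<open>
  The reflected branch of the maximum is the least value of \<open>\<alpha>\<close> at \<open>h x\<close> that keeps
  \<open>eta_lower\<close> below \<open>eta_upper\<close>.
\<close>

lemma ex_CBF_with_eta_le:
  assumes "CBF f g D h" and "CBF f g D hbar" and "b > 0"
  shows "\<exists>\<alpha> \<alpha>bar. CBF_with f g D h \<alpha> \<and> CBF_with f g D hbar \<alpha>bar \<and>
     (\<forall>x. eta_lower f h \<alpha> x \<le> eta_upper f h b \<alpha>bar x)"
proof -
  obtain \<alpha> \<beta> where \<alpha>: "CBF_with f g D h \<alpha>" and \<beta>: "CBF_with f g D hbar \<beta>"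
    using assms(1,2) by (auto simp: CBF_def)
  define m where "m = (\<lambda>s. max (\<alpha> s) (- \<beta> (b - s)))"
  have "ext_class_K_inf m"
    unfolding m_def using \<alpha> \<beta> assms(3)
    by (intro ext_class_K_inf_max_reflect) (auto simp: CBF_with_def)
  then have "CBF_with f g D h m"
    by (rule CBF_with_mono[OF \<alpha>]) (simp add: m_def)
  moreover have "eta_lower f h m x \<le> eta_upper f h b \<beta> x" for x
    by (simp add: eta_lower_def eta_upper_def m_def)
  ultimately show ?thesis
    using \<beta> by blast
qed

section \<open>Control sharing of parallel control barrier functions\<close>

theorem lemma2:
  fixes f :: "real ^ 'n \<Rightarrow> real ^ 'n"
    and g :: "real ^ 'n \<Rightarrow> real ^ 'm ^ 'n"
    and D :: "(real ^ 'n) set"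
    and h hbar :: "real ^ 'n \<Rightarrow> real"
    and b :: real
  assumes "open D"
    and "CBF f g D h"
    and "CBF f g D hbar"
    and "parallel D b h hbar"
  shows
    "(\<forall>\<alpha> \<alpha>bar. CBF_with f g D h \<alpha> \<and> CBF_with f g D hbar \<alpha>bar \<longrightarrow>
        (\<forall>x\<in>D. Lie_g g h x = 0 \<longrightarrow> eta_lower f h \<alpha> x \<le> 0 \<and> 0 \<le> eta_upper f h b \<alpha>bar x))
     \<and> (\<exists>\<alpha> \<alpha>bar. CBF_with f g D h \<alpha> \<and> CBF_with f g D hbar \<alpha>bar \<and>
        (\<forall>x\<in>D. eta_lower f h \<alpha> x \<le> eta_upper f h b \<alpha>bar x) \<and>
        control_sharing f g D h \<alpha> hbar \<alpha>bar \<and>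
        (\<forall>u0. \<forall>x\<in>D. feasible (safety_QP f g h b \<alpha> \<alpha>bar u0 x)))
     \<and> (\<forall>\<alpha> \<alpha>bar. CBF_with f g D h \<alpha> \<and> CBF_with f g D hbar \<alpha>bar \<and>
        (\<forall>x\<in>D. eta_lower f h \<alpha> x \<le> eta_upper f h b \<alpha>bar x) \<longrightarrow>
        control_sharing f g D h \<alpha> hbar \<alpha>bar \<and>
        (\<forall>u0. \<forall>x\<in>D. feasible (safety_QP f g h b \<alpha> \<alpha>bar u0 x)))"
proof -
  have "b > 0"
    using assms(4) by (simp add: parallel_def)
  note share = control_sharing_and_feasible[OF assms(1,4)]
  obtain \<alpha> \<alpha>bar where ab: "CBF_with f g D h \<alpha>" "CBF_with f g D hbar \<alpha>bar"
    and le: "\<forall>x\<in>D. eta_lower f h \<alpha> x \<le> eta_upper f h b \<alpha>bar x"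
    using ex_CBF_with_eta_le[OF assms(2,3) \<open>b > 0\<close>] by blast
  show ?thesis
  proof (intro conjI)
    show "\<forall>\<alpha> \<alpha>bar. CBF_with f g D h \<alpha> \<and> CBF_with f g D hbar \<alpha>bar \<longrightarrow>
        (\<forall>x\<in>D. Lie_g g h x = 0 \<longrightarrow> eta_lower f h \<alpha> x \<le> 0 \<and> 0 \<le> eta_upper f h b \<alpha>bar x)"
      using eta_sign_where_Lie_g_zero[OF assms(1,4)] by blast
    show "\<exists>\<alpha> \<alpha>bar. CBF_with f g D h \<alpha> \<and> CBF_with f g D hbar \<alpha>bar \<and>
        (\<forall>x\<in>D. eta_lower f h \<alpha> x \<le> eta_upper f h b \<alpha>bar x) \<and>
        control_sharing f g D h \<alpha> hbar \<alpha>bar \<and>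
        (\<forall>u0. \<forall>x\<in>D. feasible (safety_QP f g h b \<alpha> \<alpha>bar u0 x))"
      using ab le share[OF ab le] by blast
    show "\<forall>\<alpha> \<alpha>bar. CBF_with f g D h \<alpha> \<and> CBF_with f g D hbar \<alpha>bar \<and>
        (\<forall>x\<in>D. eta_lower f h \<alpha> x \<le> eta_upper f h b \<alpha>bar x) \<longrightarrow>
        control_sharing f g D h \<alpha> hbar \<alpha>bar \<and>
        (\<forall>u0. \<forall>x\<in>D. feasible (safety_QP f g h b \<alpha> \<alpha>bar u0 x))"
      using share by blast
  qed
qed

end
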